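(* Let $G$ be a path, a star, a complete graph, or a disjoint union of (finitely many) graphs each of which is a path, a star, or a complete graph. Then $\mu_g(G)\le 2$, where $\mu_g(G)$ is the majority game chromatic number of $G$.
   Context: All graphs are finite and simple. A star is a graph $K_{1,n}$. Let $G$ be a graph and $C$ a finite set of colors. A partial coloring of $G$ (an assignment of colors from $C$ to some of the vertices) satisfies the majority condition if every colored vertex $v$ has at most $\lfloor \deg(v)/2\rfloor$ colored neighbors of the same color as $v$ (here $\deg(v)$ is the degree of $v$ in $G$). The majority coloring game on $G$ with palette $C$: two players, Alice and Bob, alternately move, with Alice moving first. In a move the player chooses an uncolored vertex and assigns it a color from $C$ so that the resulting partial coloring still satisfies the majority condition (at every colored vertex). Alice wins if all vertices are eventually colored; otherwise Bob wins. The majority game chromatic number $\mu_g(G)$ is the least number of colors for which Alice has a winning strategy. *)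

theory Defs
  imports "Graph_Theory.Graph_Theory"
begin

text \<open>A finite simple graph is a \<^term>\<open>pair_graph\<close>: every edge is represented by its two
  orientations, so \<^term>\<open>out_degree\<close> is the usual degree.\<close>

definition path_graph :: "'a pair_pre_digraph \<Rightarrow> bool" where
  "path_graph G \<longleftrightarrow> (\<exists>xs. xs \<noteq> [] \<and> distinct xs \<and> pverts G = set xs \<and>
     parcs G = {(xs ! i, xs ! j) | i j.
       i < length xs \<and> j < length xs \<and> (j = Suc i \<or> i = Suc j)})"

definition star_graph :: "'a pair_pre_digraph \<Rightarrow> bool" where
  "star_graph G \<longleftrightarrow> (\<exists>n. complete_bipartite_digraph 1 n (with_proj G))"

definition complete_graph :: "'a pair_pre_digraph \<Rightarrow> bool" where
  "complete_graph G \<longleftrightarrow> (\<exists>n. complete_digraph n (with_proj G))"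

definition disjoint_union_of :: "'a pair_pre_digraph set \<Rightarrow> 'a pair_pre_digraph \<Rightarrow> bool" where
  "disjoint_union_of \<H> G \<longleftrightarrow>
     pairwise (\<lambda>H H'. pverts H \<inter> pverts H' = {}) \<H> \<and>
     pverts G = (\<Union>H\<in>\<H>. pverts H) \<and> parcs G = (\<Union>H\<in>\<H>. parcs H)"

text \<open>Partial colorings are partial functions; \<^term>\<open>None\<close> means uncolored.\<close>

definition majority_condition :: "'a pair_pre_digraph \<Rightarrow> ('a \<rightharpoonup> 'c) \<Rightarrow> bool" where
  "majority_condition G f \<longleftrightarrow> (\<forall>v \<in> pverts G. f v \<noteq> None \<longrightarrow>
     card {u. (v, u) \<in> parcs G \<and> f u = f v} \<le> out_degree (with_proj G) v div 2)"

definition legal_move ::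
  "'a pair_pre_digraph \<Rightarrow> 'c set \<Rightarrow> ('a \<rightharpoonup> 'c) \<Rightarrow> 'a \<times> 'c \<Rightarrow> bool" where
  "legal_move G C f m \<longleftrightarrow> fst m \<in> pverts G \<and> f (fst m) = None \<and> snd m \<in> C \<and>
     majority_condition G (f(fst m \<mapsto> snd m))"

text \<open>A history is the list of the moves made so far, in the order in which they were made. In a
  legal history each vertex occurs at most once, so \<^term>\<open>map_of\<close> of it is the current partial
  coloring. Alice moves after the histories of even length.\<close>

definition legal_history :: "'a pair_pre_digraph \<Rightarrow> 'c set \<Rightarrow> ('a \<times> 'c) list \<Rightarrow> bool" where
  "legal_history G C h \<longleftrightarrow> (\<forall>i < length h. legal_move G C (map_of (take i h)) (h ! i))"

definition game_over :: "'a pair_pre_digraph \<Rightarrow> 'c set \<Rightarrow> ('a \<times> 'c) list \<Rightarrow> bool" where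
  "game_over G C h \<longleftrightarrow> (\<nexists>m. legal_move G C (map_of h) m)"

definition alice_strategy ::
  "'a pair_pre_digraph \<Rightarrow> 'c set \<Rightarrow> (('a \<times> 'c) list \<Rightarrow> 'a \<times> 'c) \<Rightarrow> bool" where
  "alice_strategy G C \<sigma> \<longleftrightarrow>
     (\<forall>h. legal_history G C h \<and> even (length h) \<and> \<not> game_over G C h \<longrightarrow>
          legal_move G C (map_of h) (\<sigma> h))"

definition follows_strategy :: "(('a \<times> 'c) list \<Rightarrow> 'a \<times> 'c) \<Rightarrow> ('a \<times> 'c) list \<Rightarrow> bool" where
  "follows_strategy \<sigma> h \<longleftrightarrow> (\<forall>i < length h. even i \<longrightarrow> h ! i = \<sigma> (take i h))"

definition alice_winning_strategy ::
  "'a pair_pre_digraph \<Rightarrow> 'c set \<Rightarrow> (('a \<times> 'c) list \<Rightarrow> 'a \<times> 'c) \<Rightarrow> bool" where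
  "alice_winning_strategy G C \<sigma> \<longleftrightarrow> alice_strategy G C \<sigma> \<and>
     (\<forall>h. legal_history G C h \<and> follows_strategy \<sigma> h \<and> game_over G C h \<longrightarrow>
          pverts G \<subseteq> dom (map_of h))"

text \<open>The least number exists for every finite simple graph: with as many colors as vertices a fresh
  color is always available, so the game never gets stuck.\<close>

definition majority_game_chromatic_number :: "'a pair_pre_digraph \<Rightarrow> nat" (\<open>\<mu>\<^sub>g\<close>) where
  "\<mu>\<^sub>g G = (LEAST k. \<exists>\<sigma>. alice_winning_strategy G {..<k} \<sigma>)"

end

theory Submission
  imports Defs
begin

text \<open>Alice wins with two colors because on each component she can win even a harder game, in which
  Bob may also pass whenever it is his turn. Strategies for the harder game can be combined. On a
  disjoint union Alice answers every move of Bob in the component where he played; if he has just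
  completed that component, she makes a move in any other unfinished one, which there looks as if
  Bob had passed. Her first move in the whole game is the answer to such a pass as well. The
  predicate \<^term>\<open>alice_holds\<close> below describes the harder game by the set of
  positions in which Alice leaves a component; it is preserved by disjoint unions
  (\<open>alice_holds_disjoint_union\<close>) and yields a winning strategy
  (\<open>alice_holds_imp_winning_strategy\<close>). It remains to treat the components.

  In a complete graph nobody can get stuck: a color is unavailable only when at least half of
  the vertices have it, and as long as some vertex is uncolored this is not true of both colors.

  In a star a leaf must differ from the center, so once the center is colored the leaves never get
  stuck. Alice therefore colors the center with her first move; if Bob has colored one leaf before,
  she uses the other color.

  On a path the only danger is a vertex whose two neighbors forbid one color each. An inner
  vertex may have one neighbor of its own color, so a colored vertex forbids its color at
  an uncolored neighbor only if it already has all the equally colored neighbors that it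
  tolerates. Alice keeps every colored vertex harmless (\<open>settled\<close>): next to it there is
  a vertex of the opposite color, or an uncolored end of the path, which is bound to receive the
  opposite color. A move of Bob can unsettle only the vertex that he colors. Alice then gives the
  opposite color to an uncolored neighbor of this vertex, which settles both of them
  (\<open>opposite_color_next_to\<close>). If nothing is unsettled, she does the same next to any colored
  vertex, and on an uncolored path she starts next to an end.\<close>

section \<open>Positions that Alice can hold\<close>

definition position :: "'a pair_pre_digraph \<Rightarrow> 'c set \<Rightarrow> ('a \<rightharpoonup> 'c) \<Rightarrow> bool" where
  "position G C f \<longleftrightarrow> dom f \<subseteq> pverts G \<and> ran f \<subseteq> C \<and> majority_condition G f"

definition can_move_into ::
  "'a pair_pre_digraph \<Rightarrow> 'c set \<Rightarrow> (('a \<rightharpoonup> 'c) \<Rightarrow> bool) \<Rightarrow> ('a \<rightharpoonup> 'c) \<Rightarrow> bool" where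
  "can_move_into G C S f \<longleftrightarrow> (\<exists>m. legal_move G C f m \<and> S (f(fst m \<mapsto> snd m)))"

text \<open>The predicate \<open>S\<close> describes positions in which Bob is to move. That Alice can also move
  from such a position back into \<open>S\<close> (\<open>tempo\<close>) is what allows Bob to pass; this is needed
  because the parity of the other components may force her to move here. Complete colorings belong
  to \<open>S\<close> so that a component that Bob completes counts as held in a disjoint union.\<close>

locale alice_holds =
  fixes G :: "'a pair_pre_digraph" and C :: "'c set" and S :: "('a \<rightharpoonup> 'c) \<Rightarrow> bool"
  assumes empty: "S Map.empty"
    and position: "S f \<Longrightarrow> position G C f"
    and full: "position G C f \<Longrightarrow> dom f = pverts G \<Longrightarrow> S f"
    and tempo: "S f \<Longrightarrow> dom f \<noteq> pverts G \<Longrightarrow> can_move_into G C S f"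
    and reply: "S f \<Longrightarrow> legal_move G C f m \<Longrightarrow> dom (f(fst m \<mapsto> snd m)) \<noteq> pverts G \<Longrightarrow>
      can_move_into G C S (f(fst m \<mapsto> snd m))"

lemma position_empty: "position G C Map.empty"
  by (simp add: position_def majority_condition_def)

lemma position_legal_move:
  assumes "position G C f" "legal_move G C f m"
  shows "position G C (f(fst m \<mapsto> snd m))"
  using assms by (auto simp: position_def legal_move_def ran_map_upd)

lemma legal_move_not_full: "legal_move G C f m \<Longrightarrow> dom f \<noteq> pverts G"
  by (auto simp: legal_move_def)

text \<open>Alice moves into \<open>S\<close> whenever possible. Along a play that follows this rule, \<open>S\<close> holds
  whenever Bob is to move, and whenever Alice is to move the coloring is complete or a move into
  \<open>S\<close> exists. Neither player can then be stuck in an incomplete coloring. The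
  alternative in the definition of \<open>\<sigma>\<close> serves the histories that do not arise in this way, since
  a strategy has to be legal there too.\<close>

theorem alice_holds_imp_winning_strategy:
  assumes "alice_holds G C S"
  shows "\<exists>\<sigma>. alice_winning_strategy G C \<sigma>"
proof -
  define \<sigma> where "\<sigma> h = (if can_move_into G C S (map_of h)
      then SOME m. legal_move G C (map_of h) m \<and> S ((map_of h)(fst m \<mapsto> snd m))
      else SOME m. legal_move G C (map_of h) m)" for h
  have into_S: "legal_move G C (map_of h) (\<sigma> h) \<and> S ((map_of h)(fst (\<sigma> h) \<mapsto> snd (\<sigma> h)))"
    if "can_move_into G C S (map_of h)" for h
    using that someI_ex[of "\<lambda>m. legal_move G C (map_of h) m \<and> S ((map_of h)(fst m \<mapsto> snd m))"]
    unfolding \<sigma>_def can_move_into_def by auto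
  have legal: "legal_move G C (map_of h) (\<sigma> h)" if "\<not> game_over G C h" for h
  proof (cases "can_move_into G C S (map_of h)")
    case True
    then show ?thesis using into_S by blast
  next
    case False
    then show ?thesis
      using that someI_ex[of "legal_move G C (map_of h)"] by (auto simp: \<sigma>_def game_over_def)
  qed
  have "pverts G \<subseteq> dom (map_of h)"
    if h: "legal_history G C h" "follows_strategy \<sigma> h" "game_over G C h" for h
  proof -
    have inv: "position G C (map_of (take i h)) \<and>
        (if even i then dom (map_of (take i h)) \<noteq> pverts G \<longrightarrow>
             can_move_into G C S (map_of (take i h))
         else S (map_of (take i h)))" if "i \<le> length h" for i
      using that
    proof (induction i)
      case 0
      then show ?case
        using alice_holds.tempo[OF assms alice_holds.empty[OF assms]]
        by (simp add: position_empty)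
    next
      case (Suc i)
      let ?f = "map_of (take i h)" and ?m = "h ! i"
      from Suc.prems h(1) have m: "legal_move G C ?f ?m"
        by (auto simp: legal_history_def)
      (* map_of lets earlier entries override later ones, so freshness of the vertex matters. *)
      have next_f: "map_of (take (Suc i) h) = ?f(fst ?m \<mapsto> snd ?m)"
      proof -
        have "take (Suc i) h = take i h @ [?m]"
          using Suc.prems by (simp add: take_Suc_conv_app_nth)
        moreover have "?f (fst ?m) = None"
          using m by (simp add: legal_move_def)
        ultimately show ?thesis
          by (cases ?m) (auto simp: fun_eq_iff map_add_def split: option.split)
      qed
      have pos: "position G C ?f" using Suc by simp
      show ?case
      proof (cases "even i")
        case True
        then have "can_move_into G C S ?f" "?m = \<sigma> (take i h)"
          using Suc legal_move_not_full[OF m] h(2) by (auto simp: follows_strategy_def)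
        with into_S have "S (?f(fst ?m \<mapsto> snd ?m))" by metis
        with True position_legal_move[OF pos m] show ?thesis
          unfolding next_f by (simp only: even_Suc if_False not_True_eq_False)
      next
        case False
        then have "S ?f" using Suc by simp
        from alice_holds.reply[OF assms this m] False position_legal_move[OF pos m]
        show ?thesis
          unfolding next_f by (simp only: even_Suc if_True not_False_eq_True) blast
      qed
    qed
    have "\<not> can_move_into G C S (map_of h)"
      using h(3) by (auto simp: can_move_into_def game_over_def)
    with inv[of "length h"] alice_holds.tempo[OF assms, of "map_of h"]
    have "dom (map_of h) = pverts G" by (cases "even (length h)") auto
    then show ?thesis by simp
  qed
  then have "alice_winning_strategy G C \<sigma>"
    using legal by (simp add: alice_winning_strategy_def alice_strategy_def)
  then show ?thesis by blast
qed

section \<open>Disjoint unions\<close>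

lemma out_degree_eq_card_Image: "out_degree (with_proj G) v = card (parcs G `` {v})"
proof -
  have "out_arcs (with_proj G) v = Pair v ` (parcs G `` {v})"
    by (auto simp: out_arcs_def)
  then show ?thesis
    by (simp add: out_degree_def card_image inj_on_def)
qed

context
  fixes \<H> :: "'a pair_pre_digraph set" and G :: "'a pair_pre_digraph"
  assumes union: "disjoint_union_of \<H> G"
    and wf: "\<And>H. H \<in> \<H> \<Longrightarrow> parcs H \<subseteq> pverts H \<times> pverts H"
begin

lemma component_unique:
  "H \<in> \<H> \<Longrightarrow> H' \<in> \<H> \<Longrightarrow> v \<in> pverts H \<Longrightarrow> v \<in> pverts H' \<Longrightarrow> H = H'"
  using union unfolding disjoint_union_of_def pairwise_def by blast

lemma pverts_union: "pverts G = (\<Union>H\<in>\<H>. pverts H)"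
  using union by (simp add: disjoint_union_of_def)

lemma parcs_component:
  assumes "H \<in> \<H>" "v \<in> pverts H"
  shows "(v, u) \<in> parcs G \<longleftrightarrow> (v, u) \<in> parcs H"
proof -
  have "parcs G = (\<Union>H\<in>\<H>. parcs H)"
    using union by (simp add: disjoint_union_of_def)
  then show ?thesis
    using assms wf component_unique by fastforce
qed

text \<open>No arc leaves a component, so degrees and monochromatic neighbors can be counted inside it.\<close>

lemma majority_condition_union:
  "majority_condition G f \<longleftrightarrow> (\<forall>H\<in>\<H>. majority_condition H (f |` pverts H))"
proof -
  have same: "{u. (v, u) \<in> parcs H \<and> (f |` pverts H) u = (f |` pverts H) v} =
      {u. (v, u) \<in> parcs G \<and> f u = f v}"
    and deg: "out_degree (with_proj H) v = out_degree (with_proj G) v"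
    if "H \<in> \<H>" "v \<in> pverts H" for H v
    using that wf[OF that(1)]
    by (auto simp: parcs_component[OF that] restrict_map_def out_degree_eq_card_Image
        intro!: arg_cong[of _ _ card])
  have colored: "(f |` pverts H) v \<noteq> None \<longleftrightarrow> f v \<noteq> None" if "v \<in> pverts H" for H v
    using that by simp
  show ?thesis
    unfolding majority_condition_def pverts_union
    by (simp only: same deg colored ball_UN cong: ball_cong)
qed

lemma position_union:
  "position G C f \<longleftrightarrow> dom f \<subseteq> pverts G \<and> (\<forall>H\<in>\<H>. position H C (f |` pverts H))"
proof (cases "dom f \<subseteq> pverts G")
  case True
  then have "ran f \<subseteq> C \<longleftrightarrow> (\<forall>H\<in>\<H>. ran (f |` pverts H) \<subseteq> C)"
    by (fastforce simp: ran_def restrict_map_def pverts_union dom_def split: if_splits)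
  then show ?thesis
    using True by (auto simp: position_def majority_condition_union)
qed (simp add: position_def)

lemma restrict_upd_component:
  assumes "v \<in> A"
  shows "(f(v \<mapsto> c)) |` A = (f |` A)(v \<mapsto> c)"
  using assms by (auto simp: restrict_map_def fun_eq_iff)

lemma restrict_upd_other_component:
  assumes "H \<in> \<H>" "H' \<in> \<H>" "H' \<noteq> H" "v \<in> pverts H"
  shows "(f(v \<mapsto> c)) |` pverts H' = f |` pverts H'"
  using assms component_unique by (auto simp: restrict_map_def fun_eq_iff)

lemma legal_move_component:
  assumes "H \<in> \<H>" "fst m \<in> pverts H" "position G C f"
  shows "legal_move G C f m \<longleftrightarrow> legal_move H C (f |` pverts H) m"
proof -
  have "majority_condition G (f(fst m \<mapsto> snd m)) \<longleftrightarrow>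
      majority_condition H ((f |` pverts H)(fst m \<mapsto> snd m))"
  proof -
    have "majority_condition H' ((f(fst m \<mapsto> snd m)) |` pverts H')" if "H' \<in> \<H>" "H' \<noteq> H" for H'
      unfolding restrict_upd_other_component[OF assms(1) that assms(2)]
      using assms(3) that(1) unfolding position_def majority_condition_union by blast
    then show ?thesis
      using assms(1) unfolding majority_condition_union
      by (metis restrict_upd_component[OF assms(2)])
  qed
  then show ?thesis
    using assms by (auto simp: legal_move_def pverts_union)
qed

text \<open>After a move of Bob only his component may have left its set of safe positions, which is why
  \<open>move\<close> below does not require the component in which Alice moves to be safe beforehand. If Bob has completed his
  component, it is safe again and Alice uses \<open>tempo\<close> elsewhere.\<close>

lemma alice_holds_disjoint_union:
  assumes holds: "\<And>H. H \<in> \<H> \<Longrightarrow> alice_holds H C (S H)"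
  shows "alice_holds G C (\<lambda>f. dom f \<subseteq> pverts G \<and> (\<forall>H\<in>\<H>. S H (f |` pverts H)))"
    (is "alice_holds G C ?S")
proof -
  note position = alice_holds.position[OF holds]
  have move: "can_move_into G C ?S f"
    if H: "H \<in> \<H>" and f: "position G C f"
      and others: "\<And>H'. H' \<in> \<H> \<Longrightarrow> H' \<noteq> H \<Longrightarrow> S H' (f |` pverts H')"
      and "can_move_into H C (S H) (f |` pverts H)" for f H
  proof -
    from that(4) obtain m where m: "legal_move H C (f |` pverts H) m"
        "S H ((f |` pverts H)(fst m \<mapsto> snd m))"
      unfolding can_move_into_def by blast
    have v: "fst m \<in> pverts H" using m by (simp add: legal_move_def)
    have "legal_move G C f m" using legal_move_component[OF H v f] m by simp
    moreover have "S H' ((f(fst m \<mapsto> snd m)) |` pverts H')" if "H' \<in> \<H>" for H'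
    proof (cases "H' = H")
      case True
      then show ?thesis unfolding True restrict_upd_component[OF v] using m by simp
    next
      case False
      then show ?thesis
        unfolding restrict_upd_other_component[OF H that False v] using others that by simp
    qed
    moreover have "dom (f(fst m \<mapsto> snd m)) \<subseteq> pverts G"
      using f v H by (auto simp: position_def pverts_union)
    ultimately show ?thesis unfolding can_move_into_def by blast
  qed
  have pos: "position G C f" if "?S f" for f
    using that position by (simp add: position_union)
  have tempo: "can_move_into G C ?S f" if "?S f" "dom f \<noteq> pverts G" for f
  proof -
    from that obtain H v where H: "H \<in> \<H>" "v \<in> pverts H" "f v = None"
      by (auto simp: pverts_union dom_def)
    then have "v \<notin> dom (f |` pverts H)" by (simp add: domIff)
    with H(2) have "dom (f |` pverts H) \<noteq> pverts H" by blast
    with that H have "can_move_into H C (S H) (f |` pverts H)"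
      using alice_holds.tempo[OF holds] by blast
    with that H pos show ?thesis using move by blast
  qed
  show ?thesis
  proof (rule alice_holds.intro)
    show "?S Map.empty"
      using holds by (auto dest: alice_holds.empty simp: restrict_map_def)
  next
    fix f assume f: "position G C f" "dom f = pverts G"
    have "S H (f |` pverts H)" if "H \<in> \<H>" for H
      using f that by (intro alice_holds.full[OF holds]) (auto simp: position_union pverts_union)
    with f show "?S f" by simp
  next
    fix f m
    assume f: "?S f" and m: "legal_move G C f m"
      and part: "dom (f(fst m \<mapsto> snd m)) \<noteq> pverts G"
    let ?f' = "f(fst m \<mapsto> snd m)"
    have pos': "position G C ?f'" using position_legal_move[OF pos[OF f] m] .
    from m obtain H where H: "H \<in> \<H>" "fst m \<in> pverts H"
      by (auto simp: legal_move_def pverts_union)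
    have others: "S H' (?f' |` pverts H')" if "H' \<in> \<H>" "H' \<noteq> H" for H'
      unfolding restrict_upd_other_component[OF H(1) that H(2)] using f that by simp
    have H_upd: "?f' |` pverts H = (f |` pverts H)(fst m \<mapsto> snd m)"
      using restrict_upd_component[OF H(2)] .
    show "can_move_into G C ?S ?f'"
    proof (cases "dom (?f' |` pverts H) = pverts H")
      case True
      then have "S H (?f' |` pverts H)"
        using alice_holds.full[OF holds[OF H(1)] _ True] pos' H(1) unfolding position_union by blast
      then have "S H' (?f' |` pverts H')" if "H' \<in> \<H>" for H'
        using others that by (cases "H' = H") blast+
      with pos' have "?S ?f'" unfolding position_def by blast
      then show ?thesis using tempo part by blast
    next
      case False
      have "S H (f |` pverts H)" using f H(1) by blast
      moreover have "legal_move H C (f |` pverts H) m"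
        using m legal_move_component[OF H pos[OF f]] by blast
      ultimately have "can_move_into H C (S H) (?f' |` pverts H)"
        using alice_holds.reply[OF holds[OF H(1)]] False unfolding H_upd by blast
      then show ?thesis using move[OF H(1) pos' others] by blast
    qed
  qed (use pos tempo in blast)+
qed

end

section \<open>Complete graphs\<close>

lemma alice_holds_if_never_stuck:
  assumes "\<And>f. position G C f \<Longrightarrow> dom f \<noteq> pverts G \<Longrightarrow> \<exists>m. legal_move G C f m"
  shows "alice_holds G C (position G C)"
proof -
  have "can_move_into G C (position G C) f" if "position G C f" "dom f \<noteq> pverts G" for f
    using assms[OF that] position_legal_move[OF that(1)] unfolding can_move_into_def by blast
  then show ?thesis
    by (intro alice_holds.intro position_empty) (blast intro: position_legal_move)+
qed

text \<open>On \<open>n\<close> vertices a color can be used once more as long as at most \<open>(n - 1) div 2\<close> vertices have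
  it. With at most \<open>n - 1\<close> colored vertices this is true of the rarer color.\<close>

lemma complete_graph_holds:
  assumes "complete_graph G"
  shows "alice_holds G {..<2::nat} (position G {..<2})"
proof (rule alice_holds_if_never_stuck)
  fix f assume f: "position G {..<2::nat} f" and part: "dom f \<noteq> pverts G"
  from assms have fin: "finite (pverts G)"
      and arcs: "parcs G = {(u, v). (u, v) \<in> pverts G \<times> pverts G \<and> u \<noteq> v}"
    by (auto simp: complete_graph_def complete_digraph_pair_def)
  from f part obtain w where w: "w \<in> pverts G" "f w = None"
    by (auto simp: position_def)
  define K where "K c = {v \<in> pverts G. f v = Some c}" for c
  have fin_K: "finite (K c)" for c using fin by (simp add: K_def)
  have "card (K 0) + card (K 1) = card (K 0 \<union> K 1)"
    using fin_K by (intro card_Un_disjoint[symmetric]) (auto simp: K_def)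
  also have "\<dots> \<le> card (pverts G - {w})"
    using fin w by (intro card_mono) (auto simp: K_def)
  finally have "card (K 0) + card (K 1) \<le> card (pverts G) - 1"
    using w by simp
  then have "card (K 0) \<le> (card (pverts G) - 1) div 2 \<or> card (K 1) \<le> (card (pverts G) - 1) div 2"
    by linarith
  then obtain c where c: "c < 2" "card (K c) \<le> (card (pverts G) - 1) div 2"
    by (metis one_less_numeral_iff semiring_norm(76) zero_less_numeral)
  let ?f = "f(w \<mapsto> c)"
  have deg: "out_degree (with_proj G) v = card (pverts G) - 1" if "v \<in> pverts G" for v
  proof -
    have "parcs G `` {v} = pverts G - {v}" using that by (auto simp: arcs)
    then show ?thesis using that by (simp add: out_degree_eq_card_Image)
  qed
  have "card {u. (v, u) \<in> parcs G \<and> ?f u = ?f v} \<le> out_degree (with_proj G) v div 2"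
    if v: "v \<in> pverts G" "?f v \<noteq> None" for v
  proof (cases "?f v = Some c")
    case True
    (* An old vertex of color c gains w as a neighbor but does not count itself. *)
    have "card {u. (v, u) \<in> parcs G \<and> ?f u = ?f v} \<le> card (K c)"
    proof (cases "v = w")
      case True
      then show ?thesis by (intro card_mono fin_K) (auto simp: arcs K_def)
    next
      case False
      have "{u. (v, u) \<in> parcs G \<and> ?f u = ?f v} \<subseteq> insert w (K c - {v})"
        using True by (auto simp: arcs K_def)
      then have "card {u. (v, u) \<in> parcs G \<and> ?f u = ?f v} \<le> card (insert w (K c - {v}))"
        by (intro card_mono) (auto simp: fin_K)
      also have "\<dots> = Suc (card (K c - {v}))"
        using w fin_K by (intro card_insert_disjoint) (auto simp: K_def)
      also have "\<dots> = card (K c)"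
        using False True v by (intro card_Suc_Diff1 fin_K) (simp add: K_def)
      finally show ?thesis .
    qed
    with c deg v show ?thesis by simp
  next
    case False
    then have same: "{u. (v, u) \<in> parcs G \<and> ?f u = ?f v} = {u. (v, u) \<in> parcs G \<and> f u = f v}"
      and "f v \<noteq> None"
      using w v by (auto split: if_splits)
    then show ?thesis
      unfolding same using f v(1) unfolding position_def majority_condition_def by blast
  qed
  then have "legal_move G {..<2} f (w, c)"
    using w c by (simp add: legal_move_def majority_condition_def)
  then show "\<exists>m. legal_move G {..<2} f m" ..
qed

section \<open>Stars\<close>

lemma opposite_color:
  fixes c :: nat
  assumes "c < 2"
  shows "1 - c \<noteq> c" "1 - c < 2"
proof -
  show "1 - c \<noteq> c" using assms by arith
  show "1 - c < 2" by arith
qed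

text \<open>The safe positions are the empty one and those with a colored center. In both of them a move of
  Bob can leave the center uncolored only if it is the first move in the star, and then it colors a
  leaf, so that the opposite color is available for the center.\<close>

lemma star_graph_holds:
  assumes "star_graph G"
  shows "\<exists>S. alice_holds G {..<2::nat} S"
proof -
  from assms obtain z L where z: "pverts G = insert z L" "z \<notin> L"
      and arcs: "parcs G = {z} \<times> L \<union> L \<times> {z}" 
    by (auto simp: star_graph_def complete_bipartite_digraph_def card_1_singleton_iff)
  have majority: "majority_condition G f \<longleftrightarrow> (\<forall>v\<in>L. f v \<noteq> None \<longrightarrow> f v \<noteq> f z)"
    for f :: "'a \<rightharpoonup> nat"
  proof -
    have leaf: "card {u. (v, u) \<in> parcs G \<and> f u = f v} \<le> out_degree (with_proj G) v div 2
        \<longleftrightarrow> f v \<noteq> f z" if "v \<in> L" for v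
    proof -
      have "parcs G `` {v} = {z}" using that z by (auto simp: arcs)
      moreover have "{u. (v, u) \<in> parcs G \<and> f u = f v} = (if f v = f z then {z} else {})"
        using that z by (auto simp: arcs)
      ultimately show ?thesis by (simp add: out_degree_eq_card_Image)
    qed
    have centre: "{u. (z, u) \<in> parcs G \<and> f u = f z} = {}"
      if "\<forall>v\<in>L. f v \<noteq> None \<longrightarrow> f v \<noteq> f z" "f z \<noteq> None"
      using that z by (auto simp: arcs)
    show ?thesis
    proof
      assume "majority_condition G f"
      then show "\<forall>v\<in>L. f v \<noteq> None \<longrightarrow> f v \<noteq> f z"
        using leaf unfolding majority_condition_def z(1) by blast
    next
      assume all: "\<forall>v\<in>L. f v \<noteq> None \<longrightarrow> f v \<noteq> f z"
      show "majority_condition G f"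
        unfolding majority_condition_def
      proof (intro ballI impI)
        fix v assume v: "v \<in> pverts G" "f v \<noteq> None"
        show "card {u. (v, u) \<in> parcs G \<and> f u = f v} \<le> out_degree (with_proj G) v div 2"
        proof (cases "v = z")
          case True
          with v(2) have "f z \<noteq> None" by simp
          from centre[OF all this] show ?thesis unfolding True by (simp only: card.empty le0)
        next
          case False
          with v(1) z(1) have "v \<in> L" by blast
          moreover from this all v(2) have "f v \<noteq> f z" by blast
          ultimately show ?thesis using leaf by blast
        qed
      qed
    qed
  qed
  define S where
    "S f \<longleftrightarrow> position G {..<2::nat} f \<and> (f = Map.empty \<or> f z \<noteq> None)" for f
  have color_bound: "c < 2" if "position G {..<2} f" "f v = Some c" for f :: "'a \<rightharpoonup> nat" and v c
    using that by (auto simp: position_def ran_def)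
  have leaf_move: "can_move_into G {..<2} S f"
    if f: "position G {..<2} f" "f z \<noteq> None" "dom f \<noteq> pverts G" for f
  proof -
    from f obtain w a where w: "w \<in> L" "f w = None" "f z = Some a"
      using z by (auto simp: position_def)
    note opposite_color[OF color_bound[OF f(1) w(3)]]
    then have m: "legal_move G {..<2} f (w, 1 - a)"
      using w z f by (auto simp: legal_move_def majority position_def)
    have "S (f(w \<mapsto> 1 - a))"
      using position_legal_move[OF f(1) m] f(2) by (simp add: S_def)
    with m show ?thesis
      unfolding can_move_into_def by (intro exI[of _ "(w, 1 - a)"]) simp
  qed
  have centre_move: "can_move_into G {..<2} S f"
    if f: "position G {..<2} f" "f z = None" "a < 2" "\<forall>v\<in>L. f v = None \<or> f v = Some (1 - a)"
    for f a
  proof -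
    have m: "legal_move G {..<2} f (z, a)"
      using f z opposite_color[OF f(3)] by (auto simp: legal_move_def majority)
    have "S (f(z \<mapsto> a))"
      using position_legal_move[OF f(1) m] by (simp add: S_def)
    with m show ?thesis
      unfolding can_move_into_def by (intro exI[of _ "(z, a)"]) simp
  qed
  have "alice_holds G {..<2} S"
  proof (rule alice_holds.intro)
    fix f assume "S f" "dom f \<noteq> pverts G"
    then show "can_move_into G {..<2} S f"
      using leaf_move[of f] centre_move[of f 0] by (auto simp: S_def position_empty)
  next
    fix f m assume f: "S f" and m: "legal_move G {..<2} f m"
      and part: "dom (f(fst m \<mapsto> snd m)) \<noteq> pverts G"
    let ?f = "f(fst m \<mapsto> snd m)"
    have pos: "position G {..<2} ?f"
      using position_legal_move[OF _ m] f by (simp add: S_def)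
    show "can_move_into G {..<2} S ?f"
    proof (cases "?f z = None")
      case True
      then have "f z = None" by (simp split: if_splits)
      then have "f = Map.empty" using f by (simp add: S_def)
      moreover have "snd m < 2" using m by (simp add: legal_move_def)
      then have "1 - (1 - snd m) = snd m" by linarith
      ultimately show ?thesis
        using opposite_color[OF \<open>snd m < 2\<close>] by (intro centre_move[OF pos True, of "1 - snd m"]) simp_all
    next
      case False
      then show ?thesis using leaf_move pos part by blast
    qed
  qed (use z in \<open>auto simp: S_def position_empty\<close>)
  then show ?thesis by blast
qed

section \<open>Paths\<close>

text \<open>The first alternative covers vertices that have no uncolored neighbor to endanger. In the second
  one, \<open>u\<close> is either an uncolored leaf attached to \<open>v\<close>, which the majority condition forces to
  differ from \<open>v\<close>, or a neighbor that differs already.\<close>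

definition settled :: "'a pair_pre_digraph \<Rightarrow> ('a \<rightharpoonup> 'c) \<Rightarrow> 'a \<Rightarrow> bool" where
  "settled G f v \<longleftrightarrow> (\<forall>u. (v, u) \<in> parcs G \<longrightarrow> f u \<noteq> None) \<or>
     (\<exists>u. (v, u) \<in> parcs G \<and>
       (f u = None \<and> parcs G `` {u} = {v} \<or> f u \<noteq> None \<and> f u \<noteq> f v))"

definition settled_position :: "'a pair_pre_digraph \<Rightarrow> 'c set \<Rightarrow> ('a \<rightharpoonup> 'c) \<Rightarrow> bool" where
  "settled_position G C f \<longleftrightarrow> position G C f \<and> (\<forall>v\<in>dom f. settled G f v)"

lemma settled_cong:
  assumes "f v = f' v" "\<And>u. (v, u) \<in> parcs G \<Longrightarrow> f u = f' u"
  shows "settled G f v \<longleftrightarrow> settled G f' v"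
  using assms unfolding settled_def by (simp cong: conj_cong)

text \<open>Apart from local conditions the argument needs two global properties of a path: a partly colored
  one has an edge between a colored and an uncolored vertex, and there is a vertex that is settled
  when it alone is colored, namely a neighbor of an end or the only vertex.\<close>

locale path_like_graph =
  fixes G :: "'a pair_pre_digraph"
  assumes wf: "parcs G \<subseteq> pverts G \<times> pverts G"
    and sym: "(v, u) \<in> parcs G \<Longrightarrow> (u, v) \<in> parcs G"
    and irrefl: "(v, v) \<notin> parcs G"
    and finite_nbrs: "finite (parcs G `` {v})"
    and degree_le_2: "card (parcs G `` {v}) \<le> 2"
    and connected: "A \<subseteq> pverts G \<Longrightarrow> A \<noteq> {} \<Longrightarrow> A \<noteq> pverts G \<Longrightarrow>
      \<exists>v\<in>A. \<exists>w\<in>pverts G - A. (v, w) \<in> parcs G"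
    and next_to_end: "pverts G \<noteq> {} \<Longrightarrow>
      \<exists>w\<in>pverts G. parcs G `` {w} = {} \<or> (\<exists>u. (w, u) \<in> parcs G \<and> parcs G `` {u} = {w})"
begin

text \<open>For every degree up to two, \<open>d div 2\<close> is one less than \<open>d\<close>, unless \<open>d = 0\<close>. So the majority
  condition merely asks for one neighbor that does not share the color.\<close>

lemma majority_condition_iff:
  "majority_condition G f \<longleftrightarrow> (\<forall>v\<in>pverts G. f v \<noteq> None \<longrightarrow>
     parcs G `` {v} = {} \<or> (\<exists>u. (v, u) \<in> parcs G \<and> f u \<noteq> f v))"
proof -
  have "card {u. (v, u) \<in> parcs G \<and> f u = f v} \<le> card (parcs G `` {v}) div 2 \<longleftrightarrow>
      parcs G `` {v} = {} \<or> (\<exists>u. (v, u) \<in> parcs G \<and> f u \<noteq> f v)" (is "card ?E \<le> _ \<longleftrightarrow> ?R") for v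
  proof
    assume le: "card ?E \<le> card (parcs G `` {v}) div 2"
    show ?R
    proof (rule ccontr)
      assume not: "\<not> ?R"
      then have "?E = parcs G `` {v}" by auto
      moreover have "card (parcs G `` {v}) > 0"
        using not finite_nbrs[of v] by (auto simp: card_gt_0_iff)
      ultimately show False using le by simp
    qed
  next
    assume ?R
    then consider "parcs G `` {v} = {}" | u where "(v, u) \<in> parcs G" "f u \<noteq> f v" by blast
    then show "card ?E \<le> card (parcs G `` {v}) div 2"
    proof cases
      case 1
      then have "?E = {}" by auto
      then have "card ?E = 0" by (simp only: card.empty)
      then show ?thesis by linarith
    next
      case 2
      then have "card ?E \<le> card (parcs G `` {v} - {u})"
        using finite_nbrs by (intro card_mono) auto
      also have "\<dots> = card (parcs G `` {v}) - 1"
        using 2 finite_nbrs by (intro card_Diff_singleton) auto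
      also have "\<dots> \<le> card (parcs G `` {v}) div 2"
        using degree_le_2[of v] by linarith
      finally show ?thesis .
    qed
  qed
  then show ?thesis
    by (simp only: majority_condition_def out_degree_eq_card_Image)
qed

text \<open>The color opposite to that of \<open>v\<close> is always available at its uncolored neighbor \<open>w\<close>. The vertices
  \<open>v\<close> and \<open>w\<close> serve each other as differing neighbors. The only other vertex
  concerned is the second neighbor \<open>x\<close> of \<open>w\<close>; it is settled by some \<open>u\<close> other than \<open>w\<close>, since \<open>w\<close> is
  no leaf, and remains so.\<close>

lemma opposite_color_next_to:
  assumes f: "position G {..<2::nat} f"
    and others: "\<And>x. x \<noteq> v \<Longrightarrow> f x \<noteq> None \<Longrightarrow> settled G f x"
    and v: "f v = Some c" and w: "(v, w) \<in> parcs G" "f w = None"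
  shows "can_move_into G {..<2} (settled_position G {..<2}) f"
proof -
  let ?f = "f(w \<mapsto> 1 - c)"
  have c: "c < 2" using f v by (auto simp: position_def ran_def)
  note opp = opposite_color[OF c]
  have vw: "v \<noteq> w" "(w, v) \<in> parcs G" using v w sym by auto
  have maj: "parcs G `` {x} = {} \<or> (\<exists>u. (x, u) \<in> parcs G \<and> ?f u \<noteq> ?f x)"
    and sett: "settled G ?f x" if x: "?f x \<noteq> None" for x
  proof -
    consider "x = w" | "x = v" | "x \<noteq> v" "x \<noteq> w" "(x, w) \<notin> parcs G"
      | "x \<noteq> v" "x \<noteq> w" "(x, w) \<in> parcs G" by blast
    then have "(parcs G `` {x} = {} \<or> (\<exists>u. (x, u) \<in> parcs G \<and> ?f u \<noteq> ?f x)) \<and> settled G ?f x"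
    proof cases
      case 1
      have "?f v \<noteq> None" "?f v \<noteq> ?f w" using v vw opp by auto
      then show ?thesis using vw 1 unfolding settled_def by blast
    next
      case 2
      have "?f w \<noteq> None" "?f w \<noteq> ?f v" using v vw opp by auto
      then show ?thesis using w 2 unfolding settled_def by blast
    next
      case 3
      then have agree: "?f x = f x" "(x, u) \<in> parcs G \<Longrightarrow> ?f u = f u" for u by auto
      then have fx: "f x \<noteq> None" using x by simp
      then have "x \<in> pverts G" using f by (auto simp: position_def)
      with f fx have "parcs G `` {x} = {} \<or> (\<exists>u. (x, u) \<in> parcs G \<and> f u \<noteq> f x)"
        by (simp add: position_def majority_condition_iff)
      moreover have "settled G ?f x"
        using others[OF 3(1) fx] settled_cong[of ?f x f] agree by blast
      ultimately show ?thesis using agree by metis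
    next
      case 4
      then have fx: "f x \<noteq> None" "?f x = f x" using x by simp_all
      then obtain u where u: "(x, u) \<in> parcs G"
          "f u = None \<and> parcs G `` {u} = {x} \<or> f u \<noteq> None \<and> f u \<noteq> f x"
        using others[OF 4(1)] 4 w unfolding settled_def by blast
      (* w has the two neighbors v and x, so it is not a leaf. *)
      then have "u \<noteq> w" using 4 vw w by auto
      then have "?f u = f u" by simp
      with u fx show ?thesis unfolding settled_def by metis
    qed
    then show "parcs G `` {x} = {} \<or> (\<exists>u. (x, u) \<in> parcs G \<and> ?f u \<noteq> ?f x)" "settled G ?f x"
      by blast+
  qed
  have "majority_condition G ?f"
    using maj unfolding majority_condition_iff by blast
  then have m: "legal_move G {..<2} f (w, 1 - c)"
    using w wf opp by (auto simp: legal_move_def)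
  have "settled_position G {..<2} ?f"
    using position_legal_move[OF f m] sett unfolding settled_position_def by auto
  with m show ?thesis unfolding can_move_into_def by (intro exI[of _ "(w, 1 - c)"]) simp
qed

lemma settled_tempo:
  assumes f: "settled_position G {..<2::nat} f" and part: "dom f \<noteq> pverts G"
  shows "can_move_into G {..<2} (settled_position G {..<2}) f"
proof (cases "dom f = {}")
  case True
  then obtain w where w: "w \<in> pverts G"
      "parcs G `` {w} = {} \<or> (\<exists>u. (w, u) \<in> parcs G \<and> parcs G `` {u} = {w})"
    using part next_to_end by auto
  let ?f = "[w \<mapsto> 0::nat]"
  have None: "(w, u) \<in> parcs G \<Longrightarrow> ?f u = None" for u using irrefl by auto
  have "majority_condition G ?f"
    using w None unfolding majority_condition_iff by (fastforce split: if_splits)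
  then have m: "legal_move G {..<2} f (w, 0)"
    using True w by (auto simp: legal_move_def)
  have "settled G ?f w"
    using w None unfolding settled_def by blast
  then have "settled_position G {..<2} ?f"
    using position_legal_move[OF _ m] f True by (auto simp: settled_position_def)
  with m True show ?thesis
    unfolding can_move_into_def by (intro exI[of _ "(w, 0)"]) simp
next
  case False
  then obtain v w where "v \<in> dom f" "w \<notin> dom f" and vw: "(v, w) \<in> parcs G"
    using connected[of "dom f"] f part by (auto simp: settled_position_def position_def)
  then obtain c where "f v = Some c" "f w = None" by blast
  then show ?thesis
    using f vw by (intro opposite_color_next_to[of f v c w]) (auto simp: settled_position_def)
qed

text \<open>A move can only harm a vertex \<open>x\<close> that relied on the colored vertex \<open>w\<close> being an uncolored leaf.
  But then legality forces \<open>w\<close> to differ from \<open>x\<close>, its only neighbor.\<close>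

lemma settled_after_legal_move:
  assumes f: "settled_position G {..<2::nat} f" and m: "legal_move G {..<2} f (w, e)"
    and x: "x \<noteq> w" "f x \<noteq> None"
  shows "settled G (f(w \<mapsto> e)) x"
proof (cases "(x, w) \<in> parcs G")
  case False
  have "settled G f x" using f x by (auto simp: settled_position_def)
  moreover have "settled G (f(w \<mapsto> e)) x \<longleftrightarrow> settled G f x"
    using False x by (intro settled_cong) auto
  ultimately show ?thesis by simp
next
  case True
  let ?f = "f(w \<mapsto> e)"
  have w: "f w = None" "w \<in> pverts G" "majority_condition G ?f"
    using m by (auto simp: legal_move_def)
  have "settled G f x" using f x by (auto simp: settled_position_def)
  then obtain u where u: "(x, u) \<in> parcs G"
      "f u = None \<and> parcs G `` {u} = {x} \<or> f u \<noteq> None \<and> f u \<noteq> f x"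
    using True w(1) unfolding settled_def by blast
  show ?thesis
  proof (cases "u = w")
    case False
    then have "?f u = f u" "?f x = f x" using x by auto
    with u show ?thesis unfolding settled_def by metis
  next
    case True
    with u w have leaf: "parcs G `` {w} = {x}" by auto
    moreover have "?f w \<noteq> None" by simp
    ultimately obtain u' where "(w, u') \<in> parcs G" "?f u' \<noteq> ?f w"
      using w(2,3) unfolding majority_condition_iff by blast
    moreover from this(1) leaf have "u' = x" by blast
    ultimately have "?f w \<noteq> ?f x" by metis
    with u True \<open>?f w \<noteq> None\<close> show ?thesis unfolding settled_def by blast
  qed
qed

lemma settled_position_holds: "alice_holds G {..<2::nat} (settled_position G {..<2})"
proof (rule alice_holds.intro)
  show "settled_position G {..<2::nat} Map.empty"
    by (simp add: settled_position_def position_empty)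
next
  fix f assume "position G {..<2::nat} f" "dom f = pverts G"
  then show "settled_position G {..<2} f"
    using wf unfolding settled_position_def settled_def by blast
next
  fix f m
  assume f: "settled_position G {..<2::nat} f" and m: "legal_move G {..<2} f m"
    and part: "dom (f(fst m \<mapsto> snd m)) \<noteq> pverts G"
  obtain w e where [simp]: "m = (w, e)" by (cases m)
  let ?f = "f(w \<mapsto> e)"
  have pos: "position G {..<2} ?f"
    using position_legal_move[OF _ m] f by (simp add: settled_position_def)
  have others: "settled G ?f x" if "x \<noteq> w" "?f x \<noteq> None" for x
    using settled_after_legal_move[of f w e x] f m that by simp
  have "can_move_into G {..<2} (settled_position G {..<2}) ?f"
  proof (cases "settled G ?f w")
    case True
    then have "settled G ?f x" if "x \<in> dom ?f" for x
      using others[of x] that by (metis domIff)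
    then have "settled_position G {..<2} ?f"
      using pos unfolding settled_position_def by blast
    then show ?thesis using settled_tempo part by simp
  next
    case False
    then obtain u where "(w, u) \<in> parcs G" "?f u = None"
      unfolding settled_def by blast
    then show ?thesis
      using pos others by (intro opposite_color_next_to[of ?f w e u]) auto
  qed
  then show "can_move_into G {..<2} (settled_position G {..<2}) (f(fst m \<mapsto> snd m))"
    by simp
qed (use settled_tempo in \<open>auto simp: settled_position_def\<close>)

end

lemma path_graph_path_like:
  assumes "path_graph G"
  shows "path_like_graph G"
proof -
  from assms obtain xs where xs: "xs \<noteq> []" "distinct xs" "pverts G = set xs"
      and arcs: "parcs G = {(xs ! i, xs ! j) | i j.
        i < length xs \<and> j < length xs \<and> (j = Suc i \<or> i = Suc j)}"
    unfolding path_graph_def by blast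
  have arcI: "(xs ! i, xs ! j) \<in> parcs G"
    if "i < length xs" "j < length xs" "j = Suc i \<or> i = Suc j" for i j
    using that unfolding arcs by blast
  have nbrs: "parcs G `` {xs ! i} = (!) xs ` {j. j < length xs \<and> (j = Suc i \<or> i = Suc j)}"
    if "i < length xs" for i
    using that xs(2) by (auto simp: arcs nth_eq_iff_index_eq)
  have small: "finite (parcs G `` {v}) \<and> card (parcs G `` {v}) \<le> 2" for v
  proof (cases "v \<in> set xs")
    case True
    then obtain i where i: "i < length xs" "v = xs ! i" by (auto simp: in_set_conv_nth)
    have "parcs G `` {v} \<subseteq> {xs ! Suc i, xs ! (i - 1)}"
      using i nbrs by auto
    moreover have "card {xs ! Suc i, xs ! (i - 1)} \<le> 2"
      by (simp add: card_insert_if)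
    ultimately show ?thesis
      by (meson card_mono finite.emptyI finite.insertI finite_subset order_trans)
  next
    case False
    then have "parcs G `` {v} = {}" by (auto simp: arcs)
    then show ?thesis by simp
  qed
  have "parcs G \<subseteq> pverts G \<times> pverts G"
    unfolding arcs xs(3) by auto
  moreover have "(u, v) \<in> parcs G" if "(v, u) \<in> parcs G" for u v
    using that unfolding arcs by blast
  moreover have "(v, v) \<notin> parcs G" for v
    using xs(2) unfolding arcs by (auto simp: nth_eq_iff_index_eq)
  moreover have "\<exists>v\<in>A. \<exists>w\<in>pverts G - A. (v, w) \<in> parcs G"
    if A: "A \<subseteq> pverts G" "A \<noteq> {}" "A \<noteq> pverts G" for A
  proof (rule ccontr)
    assume none: "\<not> ?thesis"
    have step: "xs ! i \<in> A \<longleftrightarrow> xs ! Suc i \<in> A" if "Suc i < length xs" for i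
    proof -
      have "(xs ! i, xs ! Suc i) \<in> parcs G" "(xs ! Suc i, xs ! i) \<in> parcs G"
        using that by (auto intro: arcI)
      moreover have "xs ! i \<in> pverts G" "xs ! Suc i \<in> pverts G"
        using that xs(3) by auto
      ultimately show ?thesis using none by blast
    qed
    have "xs ! i \<in> A \<longleftrightarrow> xs ! 0 \<in> A" if "i < length xs" for i
      using that by (induction i) (use step in auto)
    then have "\<forall>v\<in>set xs. v \<in> A \<longleftrightarrow> xs ! 0 \<in> A" by (metis in_set_conv_nth)
    then show False using A xs(3) by blast
  qed
  moreover have "\<exists>w\<in>pverts G. parcs G `` {w} = {} \<or> (\<exists>u. (w, u) \<in> parcs G \<and> parcs G `` {u} = {w})"
  proof (cases "length xs = 1")
    case True
    then have "parcs G `` {xs ! 0} = {}" using nbrs[of 0] by auto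
    moreover have "xs ! 0 \<in> pverts G" using True xs(3) by auto
    ultimately show ?thesis by blast
  next
    case False
    then have len: "1 < length xs" using xs(1) by (cases xs) auto
    then have "{j. j < length xs \<and> (j = Suc 0 \<or> 0 = Suc j)} = {1}" "0 < length xs" by auto
    then have "parcs G `` {xs ! 0} = {xs ! 1}"
      using nbrs by (simp only: image_insert image_empty)
    moreover have "xs ! 1 \<in> pverts G" using len xs(3) by auto
    moreover have "(xs ! 1, xs ! 0) \<in> parcs G" using len by (intro arcI) auto
    ultimately show ?thesis by blast
  qed
  ultimately show ?thesis
    using small by (intro path_like_graph.intro) simp_all
qed

section \<open>The bound\<close>

lemma component_holds:
  assumes "path_graph H \<or> star_graph H \<or> complete_graph H"
  shows "parcs H \<subseteq> pverts H \<times> pverts H" "\<exists>S. alice_holds H {..<2::nat} S"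
proof -
  show "parcs H \<subseteq> pverts H \<times> pverts H"
    using assms
    by (auto simp: path_graph_def star_graph_def complete_bipartite_digraph_def
        complete_graph_def complete_digraph_pair_def)
  show "\<exists>S. alice_holds H {..<2::nat} S"
    using assms path_like_graph.settled_position_holds[OF path_graph_path_like]
      star_graph_holds complete_graph_holds by blast
qed

theorem theorem1p2:
  fixes G :: "'a pair_pre_digraph"
  assumes "pair_graph G"
    and "path_graph G \<or> star_graph G \<or> complete_graph G \<or>
      (\<exists>\<H>. finite \<H> \<and> disjoint_union_of \<H> G \<and>
         (\<forall>H \<in> \<H>. path_graph H \<or> star_graph H \<or> complete_graph H))"
  shows "\<mu>\<^sub>g G \<le> 2"
proof -
  have "\<exists>S. alice_holds G {..<2::nat} S"
    using assms(2)
  proof (elim disjE exE conjE)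
    fix \<H> assume union: "disjoint_union_of \<H> G"
      and "\<forall>H\<in>\<H>. path_graph H \<or> star_graph H \<or> complete_graph H"
    then have wf: "parcs H \<subseteq> pverts H \<times> pverts H" and "\<exists>S. alice_holds H {..<2::nat} S"
      if "H \<in> \<H>" for H
      using that component_holds by blast+
    then obtain S where "alice_holds H {..<2::nat} (S H)" if "H \<in> \<H>" for H
      by metis
    from alice_holds_disjoint_union[OF union wf this] show ?thesis by blast
  qed (blast intro: component_holds)+
  then have "\<exists>\<sigma>. alice_winning_strategy G {..<2::nat} \<sigma>"
    using alice_holds_imp_winning_strategy by blast
  then show ?thesis
    unfolding majority_game_chromatic_number_def by (rule Least_le)
qed

end
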